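(* Let $M\ge 1$ be an integer, $(R_j)_{j\in\mathbb Z}$ non-negative real numbers, and $(P_i,C_i)$, $i=1,\dots,N$ ($N\ge 0$), real pairs with $P_i\ge 0$. Then the function $F^s_j=T(P_1,\dots,P_N;C_1,\dots,C_N)(s,j)$ generated by the vertex operator $$X(P_{k+1},C_{k+1})\,T(\boldsymbol P;\boldsymbol C)=\max\big(T(\boldsymbol P;\boldsymbol C),\;2\eta_{k+1}+T(\boldsymbol P;\boldsymbol C-\boldsymbol A_{k+1})\big)$$ solves the non-autonomous ultradiscrete hungry KdV equation: for all $s,j\in\mathbb Z$, $$F^{s+M+1}_{j+1}+F^{s}_{j}=\max\big(F^{s+M+1}_{j}+F^{s}_{j+1}-2R_j,\;F^{s+1}_{j}+F^{s+M}_{j+1}\big).$$ In particular $X$ maps $N$-soliton solutions of this equation to $(N+1)$-soliton solutions.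
   Context: Here, for $s,j\in\mathbb Z$, $\eta_i(s,j)=C_i+sP_i-\sum_{0}^{j}\Omega_{i,d}$ with $\Omega_{i,j}=\min(R_{j-1},MP_i)$, where $\sum_{a}^{b}\Omega_{i,d}$ denotes $\sum_{d=a+1}^{b}\Omega_{i,d}$ if $a<b$, $0$ if $a=b$, and $-\sum_{d=b+1}^{a}\Omega_{i,d}$ if $a>b$. The interaction terms are $A_{i,j}=(M+1)\min(P_i,P_j)$ and $\boldsymbol A_{k+1}=(A_{k+1,1},\dots,A_{k+1,k})$. The functions $T(\boldsymbol P;\boldsymbol C)=T(P_1,\dots,P_k;C_1,\dots,C_k)$ on $\mathbb Z^2$ (in the variables $(s,j)$) are defined recursively by $T(;)=0$ and $T(P_1,\dots,P_{k+1};C_1,\dots,C_{k+1})=X(P_{k+1},C_{k+1})T(P_1,\dots,P_k;C_1,\dots,C_k)$ with the displayed formula for $X$; these functions are the $k$-soliton solutions. *)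

theory Defs
  imports Complex_Main
begin

text \<open>
  The tuples \<open>(P\<^sub>1, \<dots>, P\<^sub>k)\<close> and \<open>(C\<^sub>1, \<dots>, C\<^sub>k)\<close> are functions on \<^typ>\<open>nat\<close>
  of which only the values at \<open>1, \<dots>, k\<close> are used.
\<close>

definition signed_sum :: "int \<Rightarrow> int \<Rightarrow> (int \<Rightarrow> real) \<Rightarrow> real" where
  "signed_sum a b f =
     (if a < b then \<Sum>d = a + 1..b. f d
      else if a = b then 0
      else - (\<Sum>d = b + 1..a. f d))"

definition Omega :: "nat \<Rightarrow> (int \<Rightarrow> real) \<Rightarrow> real \<Rightarrow> int \<Rightarrow> real" where
  "Omega M R p j = min (R (j - 1)) (real M * p)"

definition eta :: "nat \<Rightarrow> (int \<Rightarrow> real) \<Rightarrow> real \<Rightarrow> real \<Rightarrow> int \<Rightarrow> int \<Rightarrow> real" where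
  "eta M R p c s j = c + of_int s * p - signed_sum 0 j (Omega M R p)"

definition interaction :: "nat \<Rightarrow> real \<Rightarrow> real \<Rightarrow> real" where
  "interaction M p q = (real M + 1) * min p q"

text \<open>
  The vertex operator \<open>X(p, c)\<close> evaluates its argument at shifted phases, so it acts on the
  whole family \<open>G = T(P; \<cdot>)\<close>, indexed by the phase tuple, and not on a single function of
  \<open>(s, j)\<close>.
\<close>

definition vertex_op ::
  "nat \<Rightarrow> (int \<Rightarrow> real) \<Rightarrow> (nat \<Rightarrow> real) \<Rightarrow> real \<Rightarrow> real \<Rightarrow>
   ((nat \<Rightarrow> real) \<Rightarrow> int \<Rightarrow> int \<Rightarrow> real) \<Rightarrow> (nat \<Rightarrow> real) \<Rightarrow> int \<Rightarrow> int \<Rightarrow> real" where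
  "vertex_op M R P p c G C s j =
     max (G C s j) (2 * eta M R p c s j + G (\<lambda>i. C i - interaction M p (P i)) s j)"

primrec T ::
  "nat \<Rightarrow> (int \<Rightarrow> real) \<Rightarrow> nat \<Rightarrow> (nat \<Rightarrow> real) \<Rightarrow> (nat \<Rightarrow> real) \<Rightarrow> int \<Rightarrow> int \<Rightarrow> real" where
  "T M R 0 P = (\<lambda>C s j. 0)"
| "T M R (Suc k) P = (\<lambda>C. vertex_op M R P (P (Suc k)) (C (Suc k)) (T M R k P) C)"

definition solves_uhKdV :: "nat \<Rightarrow> (int \<Rightarrow> real) \<Rightarrow> (int \<Rightarrow> int \<Rightarrow> real) \<Rightarrow> bool" where
  "solves_uhKdV M R F \<longleftrightarrow>
     (\<forall>s j. F (s + int M + 1) (j + 1) + F s j =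
        max (F (s + int M + 1) j + F s (j + 1) - 2 * R j)
            (F (s + 1) j + F (s + int M) (j + 1)))"

definition soliton_solution ::
  "nat \<Rightarrow> (int \<Rightarrow> real) \<Rightarrow> nat \<Rightarrow> (int \<Rightarrow> int \<Rightarrow> real) \<Rightarrow> bool" where
  "soliton_solution M R k F \<longleftrightarrow>
     solves_uhKdV M R F \<and> (\<exists>P C. (\<forall>i\<in>{1..k}. 0 \<le> P i) \<and> F = T M R k P C)"

end

(* Unfolding the recursion, T is the maximum over subsets S of {1..k} of a sum of phases minus
   pairwise interactions. This is symmetric in the solitons, so they may be inserted in increasing
   order of P. Inserting a soliton whose P is the largest shifts all other phases by (M + 1) P_i,
   which is the shift of s by -(M + 1):
     g(s) = max (f(s)) (x + s p + f(s - M - 1)).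
   It remains to see that this map preserves the equation. For fixed j write f = F_j and
   h = F_{j+1}. If M P_i <= R_j for all i, then h(s) = f(s - M), and the equation reduces to a
   bound on the growth of the slope of f over a distance M + 1. Otherwise the new soliton has
   Omega = R_j; comparing the terms of both sides of the equation by their degree in exp x,
   degrees 0 and 2 are the old equation, and degree 1 follows from the old equation, the slope
   bounds, and one further inequality between f and h which is preserved as well. *)

theory Submission
  imports Defs
begin

section \<open>Conditions on functions of \<open>s\<close> at fixed \<open>j\<close>\<close>

definition slope_bounded :: "nat \<Rightarrow> real \<Rightarrow> (int \<Rightarrow> real) \<Rightarrow> bool" where
  "slope_bounded M p f \<longleftrightarrow> (\<forall>s. f (s + 1) + f (s - int M - 1) \<le> p + f s + f (s - int M))"

text \<open>The equation at one \<open>j\<close>: \<open>f\<close> and \<open>h\<close> are the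
  solution at \<open>j\<close> and \<open>j + 1\<close>, and \<open>r\<close> stands for
  \<open>2 * R j\<close>.\<close>

definition bilinear_eq :: "nat \<Rightarrow> real \<Rightarrow> (int \<Rightarrow> real) \<Rightarrow> (int \<Rightarrow> real) \<Rightarrow> bool" where
  "bilinear_eq M r f h \<longleftrightarrow>
     (\<forall>s. h (s + int M + 1) + f s = max (f (s + int M + 1) + h s - r) (f (s + 1) + h (s + int M)))"

text \<open>Compares the growth of \<open>h\<close> on \<open>[s, s + M]\<close> with that of
  \<open>f\<close> on \<open>[s - M, s]\<close>. If \<open>h\<close> is \<open>f\<close> delayed by
  \<open>M\<close>, it amounts to \<open>r \<le> M * p\<close>.\<close>

definition cross_bounded :: "nat \<Rightarrow> real \<Rightarrow> real \<Rightarrow> (int \<Rightarrow> real) \<Rightarrow> (int \<Rightarrow> real) \<Rightarrow> bool" where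
  "cross_bounded M p r f h \<longleftrightarrow>
     (\<forall>s. h (s + int M) + f (s - int M) \<le> real M * p - r + h s + f s)"

text \<open>Here \<open>p\<close> and \<open>x\<close> are twice the \<open>P\<close> and the phase
  of the new soliton, which absorbs the factor 2 of the vertex operator.\<close>

definition add_soliton :: "nat \<Rightarrow> real \<Rightarrow> real \<Rightarrow> (int \<Rightarrow> real) \<Rightarrow> int \<Rightarrow> real" where
  "add_soliton M p x f s = max (f s) (x + of_int s * p + f (s - int M - 1))"

text \<open>When \<open>b\<close> and \<open>d\<close> carry the new soliton, the four assumptions
  are comparisons in degrees 0, 1, 1 and 2 in exp x.\<close>

lemma max_add_max_le:
  fixes a b c d :: real
  assumes "a + c \<le> k" "a + d \<le> k" "b + c \<le> k" "b + d \<le> k"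
  shows "max a b + max c d \<le> k"
  using assms by (simp add: max_def)

lemma slope_boundedD:
  assumes "slope_bounded M p f"
  shows "f (s + 1) + f (s - int M - 1) \<le> p + f s + f (s - int M)"
  using assms by (simp add: slope_bounded_def)

lemma bilinear_eqD:
  assumes "bilinear_eq M r f h"
  shows "h (s + int M + 1) + f s = max (f (s + int M + 1) + h s - r) (f (s + 1) + h (s + int M))"
  using assms by (simp add: bilinear_eq_def)

lemma bilinear_eq_shift:
  assumes "bilinear_eq M r f h"
  shows "h s + f (s - int M - 1) = max (f s + h (s - int M - 1) - r) (f (s - int M) + h (s - 1))"
  using bilinear_eqD[OF assms, of "s - int M - 1"] by (simp add: algebra_simps)

lemma cross_boundedD:
  assumes "cross_bounded M p r f h"
  shows "h (s + int M) + f (s - int M) \<le> real M * p - r + h s + f s"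
  using assms by (simp add: cross_bounded_def)

text \<open>Telescoping sum of the slope bounds at \<open>s, ..., s + n - 1\<close>.\<close>

lemma slope_bounded_iterate:
  assumes "slope_bounded M p f"
  shows "f (s + int n) + f (s - int M - 1) \<le> real n * p + f s + f (s - int M - 1 + int n)"
proof (induction n)
  case (Suc n)
  show ?case
    using Suc slope_boundedD[OF assms, of "s + int n"] by (simp add: algebra_simps)
qed simp

lemma slope_bounded_mono: "slope_bounded M p f \<Longrightarrow> p \<le> q \<Longrightarrow> slope_bounded M q f"
  unfolding slope_bounded_def by (meson add_right_mono order_trans)

lemma cross_bounded_mono:
  assumes c: "cross_bounded M p r f h" and "p \<le> q"
  shows "cross_bounded M q r f h"
  unfolding cross_bounded_def
proof
  fix s
  have "real M * p \<le> real M * q"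
    using assms by (simp add: mult_left_mono)
  then show "h (s + int M) + f (s - int M) \<le> real M * q - r + h s + f s"
    using cross_boundedD[OF c, of s] by linarith
qed

section \<open>Preservation of the conditions under insertion of a soliton\<close>

lemma slope_bounded_add_soliton:
  assumes f: "slope_bounded M p f"
  shows "slope_bounded M p (add_soliton M p x f)"
  unfolding slope_bounded_def
proof
  fix s
  have a: "f (s + 1) + f (s - int M - 1) \<le> p + f s + f (s - int M)"
    by (rule slope_boundedD[OF f])
  have b: "f (s - int M) + f (s - 2 * int M - 2) \<le> p + f (s - int M - 1) + f (s - 2 * int M - 1)"
    using slope_boundedD[OF f, of "s - int M - 1"] by (simp add: algebra_simps)
  show "add_soliton M p x f (s + 1) + add_soliton M p x f (s - int M - 1)
      \<le> p + add_soliton M p x f s + add_soliton M p x f (s - int M)"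
    \<comment> \<open>In degree 1, one term on the left equals a term on the right; the other is
      bounded by adding \<open>a\<close> and \<open>b\<close>, where the values at
      \<open>s - M\<close> and \<open>s - M - 1\<close> cancel.\<close>
    using a b unfolding add_soliton_def max_def
    by (auto simp: algebra_simps)
qed

text \<open>The left side equals the second alternative of the maximum; the first exceeds it by at
  most \<open>M * p - r\<close>, by the slope bound over \<open>M\<close> steps.\<close>

lemma bilinear_eq_delay:
  assumes f: "slope_bounded M p f" and r: "real M * p \<le> r"
  shows "bilinear_eq M r f (\<lambda>s. f (s - int M))"
  unfolding bilinear_eq_def
proof
  fix s
  have "f (s + 1 + int M) + f (s - int M) \<le> real M * p + f (s + 1) + f s"
    using slope_bounded_iterate[OF f, of "s + 1" M] by (simp add: algebra_simps)
  then show "f (s + int M + 1 - int M) + f s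
      = max (f (s + int M + 1) + f (s - int M) - r) (f (s + 1) + f (s + int M - int M))"
    using r by (simp add: algebra_simps max_def)
qed

text \<open>Degrees 0 and 2 are the old bound at \<open>s\<close> and at \<open>s - M - 1\<close>.
  Both terms of degree 1 on the left are bounded by the one pairing \<open>h s\<close> with
  \<open>y + f (s - ?m)\<close>.\<close>

lemma cross_bounded_add_soliton:
  assumes f: "slope_bounded M p f" and e: "bilinear_eq M r f h" and c: "cross_bounded M p r f h"
  shows "cross_bounded M p r (add_soliton M p x f) (add_soliton M p (x - r) h)"
  unfolding cross_bounded_def
proof
  fix s
  let ?m = "int M + 1"
  define y where "y = x + of_int s * p"
  have c0: "h (s + int M) + f (s - int M) \<le> real M * p - r + h s + f s"
    by (rule cross_boundedD[OF c])
  have c1: "h (s - 1) + f (s - 2 * int M - 1) \<le> real M * p - r + h (s - ?m) + f (s - ?m)"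
    using cross_boundedD[OF c, of "s - ?m"] by (simp add: algebra_simps)
  have e1: "h s + f (s - ?m) = max (f s + h (s - ?m) - r) (f (s - int M) + h (s - 1))"
    using bilinear_eq_shift[OF e, of s] by (simp add: algebra_simps)
  have sl: "f s + f (s - 2 * int M - 1) \<le> real M * p + f (s - int M) + f (s - ?m)"
    using slope_bounded_iterate[OF f, of "s - int M" M] by (simp add: algebra_simps)
  have g: "add_soliton M p x f s = max (f s) (y + f (s - ?m))"
    "add_soliton M p (x - r) h s = max (h s) (y - r + h (s - ?m))"
    "add_soliton M p (x - r) h (s + int M) = max (h (s + int M)) (y - r + real M * p + h (s - 1))"
    "add_soliton M p x f (s - int M)
      = max (f (s - int M)) (y - real M * p + f (s - 2 * int M - 1))"
    by (simp_all add: add_soliton_def y_def algebra_simps)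
  show "add_soliton M p (x - r) h (s + int M) + add_soliton M p x f (s - int M)
      \<le> real M * p - r + add_soliton M p (x - r) h s + add_soliton M p x f s"
    unfolding g
  proof (rule max_add_max_le, goal_cases)
    case 1
    show ?case using c0 by linarith
  next
    case 2
    show ?case using c0 e1 sl by linarith
  next
    case 3
    show ?case using e1 by linarith
  next
    case 4
    show ?case using c1 by linarith
  qed
qed

text \<open>In degree 1 the term \<open>y - r + (M + 1) * p + h s + f s\<close> occurs on both sides
  and dominates all others: this is the content of \<open>k1\<close>, \<open>k2\<close>,
  \<open>k4\<close> and \<open>c3\<close>.\<close>

lemma bilinear_eq_add_soliton:
  assumes f: "slope_bounded M p f" and h: "slope_bounded M p h"
    and e: "bilinear_eq M r f h" and c: "cross_bounded M p r f h"
  shows "bilinear_eq M r (add_soliton M p x f) (add_soliton M p (x - r) h)"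
  unfolding bilinear_eq_def
proof
  fix s
  let ?m = "int M + 1"
  define y where "y = x + of_int s * p"
  have e0: "h (s + ?m) + f s = max (f (s + ?m) + h s - r) (f (s + 1) + h (s + int M))"
    using bilinear_eqD[OF e, of s] by (simp add: algebra_simps)
  have e1: "h s + f (s - ?m) = max (f s + h (s - ?m) - r) (f (s - int M) + h (s - 1))"
    using bilinear_eq_shift[OF e, of s] by (simp add: algebra_simps)
  have sf1: "f (s + 1) + f (s - ?m) \<le> p + f s + f (s - int M)"
    using slope_boundedD[OF f, of s] by (simp add: algebra_simps)
  have sfm: "f (s + ?m) + f (s - ?m) \<le> (real M + 1) * p + f s + f s"
    using slope_bounded_iterate[OF f, of s "M + 1"] by (simp add: algebra_simps)
  have shm: "h (s + ?m) + h (s - ?m) \<le> (real M + 1) * p + h s + h s"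
    using slope_bounded_iterate[OF h, of s "M + 1"] by (simp add: algebra_simps)
  have sh1: "h (s + ?m) + h (s - 1) \<le> p + h (s + int M) + h s"
    using slope_boundedD[OF h, of "s + int M"] by (simp add: algebra_simps)
  have c3: "h (s + int M) + f (s - int M) \<le> real M * p - r + h s + f s"
    by (rule cross_boundedD[OF c])
  \<comment> \<open>If the first alternative in \<open>e0\<close> attains the maximum,
    \<open>sfm\<close> suffices; for the second, \<open>sf1\<close> and \<open>c3\<close> are
    chained.\<close>
  have k1: "h (s + ?m) + f (s - ?m) \<le> (real M + 1) * p - r + h s + f s"
    using e0 c3 sf1 sfm by (simp add: algebra_simps max_def split: if_splits)
  have k2: "f (s + ?m) + h (s - ?m) \<le> (real M + 1) * p + r + h s + f s"
    using e0 shm by linarith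
  have k4: "f (s + 1) + h (s - 1) \<le> p + h s + f s"
    using e0 sh1 by linarith
  have g: "add_soliton M p x f s = max (f s) (y + f (s - ?m))"
    "add_soliton M p (x - r) h s = max (h s) (y - r + h (s - ?m))"
    "add_soliton M p (x - r) h (s + int M) = max (h (s + int M)) (y - r + real M * p + h (s - 1))"
    "add_soliton M p (x - r) h (s + int M + 1) = max (h (s + ?m)) (y - r + (real M + 1) * p + h s)"
    "add_soliton M p x f (s + int M + 1) = max (f (s + ?m)) (y + (real M + 1) * p + f s)"
    "add_soliton M p x f (s + 1) = max (f (s + 1)) (y + p + f (s - int M))"
    by (simp_all add: add_soliton_def y_def algebra_simps)
  have mp: "(real M + 1) * p = real M * p + p"
    by (simp add: algebra_simps)
  show "add_soliton M p (x - r) h (s + int M + 1) + add_soliton M p x f s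
     = max (add_soliton M p x f (s + int M + 1) + add_soliton M p (x - r) h s - r)
           (add_soliton M p x f (s + 1) + add_soliton M p (x - r) h (s + int M))"
    (is "?L = max ?A ?B")
  proof (intro antisym max.boundedI)
    show "?L \<le> max ?A ?B"
      unfolding g
    proof (rule max_add_max_le, goal_cases)
      case 1
      show ?case using e0 by linarith
    next
      case 2
      show ?case using k1 by linarith
    next
      case 3
      show ?case by linarith
    next
      case 4
      show ?case using e1 mp by linarith
    qed
    \<comment> \<open>The summand \<open>- r\<close> of \<open>?A\<close> moves to the right, so
      that a plain sum of two maxima remains on the left.\<close>
    have "max (f (s + ?m)) (y + (real M + 1) * p + f s) + max (h s) (y - r + h (s - ?m))
        \<le> r + (add_soliton M p (x - r) h (s + int M + 1) + add_soliton M p x f s)"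
      unfolding g
    proof (rule max_add_max_le, goal_cases)
      case 1
      show ?case using e0 by linarith
    next
      case 2
      show ?case using k2 by linarith
    next
      case 3
      show ?case by linarith
    next
      case 4
      show ?case using e1 by linarith
    qed
    then show "?A \<le> ?L"
      unfolding g by linarith
    show "?B \<le> ?L"
      unfolding g
    proof (rule max_add_max_le, goal_cases)
      case 1
      show ?case using e0 by linarith
    next
      case 2
      show ?case using k4 mp by linarith
    next
      case 3
      show ?case using c3 mp by linarith
    next
      case 4
      show ?case using e1 mp by linarith
    qed
  qed
qed

section \<open>Maximum over subsets of solitons\<close>

text \<open>Each pair is counted twice by the double sum, in accordance with the factor 2 of the phases.\<close>

definition tau :: "('a \<Rightarrow> 'a \<Rightarrow> real) \<Rightarrow> 'a set \<Rightarrow> ('a \<Rightarrow> real) \<Rightarrow> real" where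
  "tau B A w = Max ((\<lambda>S. \<Sum>i\<in>S. 2 * w i - (\<Sum>l\<in>S - {i}. B i l)) ` Pow A)"

lemma tau_empty [simp]: "tau B {} w = 0"
  by (simp add: tau_def)

lemma tau_cong:
  assumes "\<And>i. i \<in> A \<Longrightarrow> w i = w' i"
    and "\<And>i l. i \<in> A \<Longrightarrow> l \<in> A \<Longrightarrow> B i l = B' i l"
  shows "tau B A w = tau B' A w'"
  unfolding tau_def using assms
  by (intro arg_cong[where f = Max] image_cong refl sum.cong arg_cong2[where f = minus]) auto

text \<open>Split the subsets by whether they contain \<open>a\<close>. In those that do, each other
  \<open>i\<close> meets \<open>a\<close> twice in the double sum, which is the effect of lowering
  \<open>w i\<close> by \<open>B a i\<close>.\<close>

lemma tau_insert:
  fixes B :: "'a \<Rightarrow> 'a \<Rightarrow> real"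
  assumes A: "finite A" "a \<notin> A" and sym: "\<And>i l. B i l = B l i"
  shows "tau B (insert a A) w = max (tau B A w) (2 * w a + tau B A (\<lambda>i. w i - B a i))"
proof -
  define E where "E w S = (\<Sum>i\<in>S. 2 * w i - (\<Sum>l\<in>S - {i}. B i l))" for w S
  have ins: "E w (insert a S) = E (\<lambda>i. w i - B a i) S + 2 * w a" if "S \<in> Pow A" for S
  proof -
    have S: "finite S" "a \<notin> S"
      using that A finite_subset by auto
    have "(\<Sum>l\<in>insert a S - {i}. B i l) = B a i + (\<Sum>l\<in>S - {i}. B i l)" if "i \<in> S" for i
    proof -
      have "insert a S - {i} = insert a (S - {i})"
        using S that by auto
      then show ?thesis
        using S sym[of i a] by simp
    qed
    then have "E w (insert a S)
        = 2 * w a - (\<Sum>l\<in>S. B a l) + (\<Sum>i\<in>S. 2 * w i - (B a i + (\<Sum>l\<in>S - {i}. B i l)))"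
      using S by (simp add: E_def cong: sum.cong)
    also have "\<dots> = E (\<lambda>i. w i - B a i) S + 2 * w a"
      by (simp add: E_def sum_subtractf sum.distrib algebra_simps flip: sum_distrib_right)
    finally show ?thesis .
  qed
  have "E w ` Pow (insert a A) = E w ` Pow A \<union> (\<lambda>S. E (\<lambda>i. w i - B a i) S + 2 * w a) ` Pow A"
    unfolding Pow_insert image_Un image_image using ins by (auto simp: image_iff)
  then have "Max (E w ` Pow (insert a A))
      = max (Max (E w ` Pow A)) (Max ((\<lambda>S. E (\<lambda>i. w i - B a i) S + 2 * w a) ` Pow A))"
    using A by (simp add: Max_Un Pow_not_empty)
  also have "Max ((\<lambda>S. E (\<lambda>i. w i - B a i) S + 2 * w a) ` Pow A)
      = Max (E (\<lambda>i. w i - B a i) ` Pow A) + 2 * w a"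
    using A by (intro Max_add_commute) (auto simp: Pow_not_empty)
  finally show ?thesis
    by (simp add: tau_def E_def add.commute)
qed

section \<open>Soliton waves at fixed \<open>j\<close>\<close>

lemma interaction_commute: "interaction M p q = interaction M q p"
  by (simp add: interaction_def min.commute)

text \<open>Indexing by a set instead of a tuple makes the symmetry in the solitons automatic. The
  phases \<open>c\<close> are meant to include the part of \<open>eta\<close> that depends on
  \<open>j\<close>.\<close>

definition wave :: "nat \<Rightarrow> ('a \<Rightarrow> real) \<Rightarrow> 'a set \<Rightarrow> ('a \<Rightarrow> real) \<Rightarrow> int \<Rightarrow> real" where
  "wave M P A c s = tau (\<lambda>i l. interaction M (P i) (P l)) A (\<lambda>i. c i + of_int s * P i)"

lemma wave_empty [simp]: "wave M P {} c s = 0"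
  by (simp add: wave_def)

lemma wave_insert:
  assumes "finite A" "a \<notin> A"
  shows "wave M P (insert a A) c s =
    max (wave M P A c s)
        (2 * (c a + of_int s * P a) + wave M P A (\<lambda>i. c i - interaction M (P a) (P i)) s)"
proof -
  have "(\<lambda>i. c i - interaction M (P a) (P i) + of_int s * P i)
      = (\<lambda>i. c i + of_int s * P i - interaction M (P a) (P i))"
    by auto
  then show ?thesis
    unfolding wave_def
    using tau_insert[OF assms, of "\<lambda>i l. interaction M (P i) (P l)" "\<lambda>i. c i + of_int s * P i"]
    by (simp add: interaction_commute)
qed

lemma wave_insert_largest:
  assumes "finite A" "a \<notin> A" and le: "\<And>i. i \<in> A \<Longrightarrow> P i \<le> P a"
  shows "wave M P (insert a A) c = add_soliton M (2 * P a) (2 * c a) (wave M P A c)"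
proof
  fix s
  have "wave M P A (\<lambda>i. c i - interaction M (P a) (P i)) s = wave M P A c (s - int M - 1)"
    unfolding wave_def
    by (intro tau_cong) (auto simp: interaction_def min_absorb2[OF le] algebra_simps)
  then show "wave M P (insert a A) c s = add_soliton M (2 * P a) (2 * c a) (wave M P A c) s"
    using wave_insert[OF assms(1,2)] by (simp add: add_soliton_def algebra_simps)
qed

lemma wave_delay:
  assumes "\<And>i. i \<in> A \<Longrightarrow> real M * P i \<le> r"
  shows "wave M P A (\<lambda>i. c i - min r (real M * P i)) = (\<lambda>s. wave M P A c (s - int M))"
  unfolding wave_def using assms
  by (intro ext tau_cong) (auto simp: min_absorb2 algebra_simps)

lemma slope_bounded_wave:
  assumes "finite A" "0 \<le> p" "\<And>i. i \<in> A \<Longrightarrow> 0 \<le> P i" "\<And>i. i \<in> A \<Longrightarrow> P i \<le> p"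
  shows "slope_bounded M (2 * p) (wave M P A c)"
  using assms
proof (induction A arbitrary: p rule: finite_ranking_induct[where f = P])
  case empty
  then show ?case
    by (simp add: slope_bounded_def)
next
  case (insert a A)
  show ?case
  proof (cases "a \<in> A")
    case True
    then show ?thesis
      using insert by (simp add: insert_absorb)
  next
    case False
    \<comment> \<open>The induction hypothesis is taken at \<open>P a\<close> instead of
      \<open>p\<close>, since the bound must match the soliton being inserted; it is relaxed to
      \<open>p\<close> afterwards.\<close>
    have "slope_bounded M (2 * P a) (wave M P A c)"
      using insert by auto
    then have "slope_bounded M (2 * P a) (wave M P (insert a A) c)"
      using insert.hyps False by (simp add: wave_insert_largest slope_bounded_add_soliton)
    then show ?thesis
      using insert.prems by (auto elim: slope_bounded_mono)
  qed
qed

text \<open>Each insertion with \<open>r \<le> M * P a\<close> uses both claims for the smaller set,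
  so they are proved together. The condition \<open>r \<le> M * p\<close> is what the cross bound
  says for a pure delay.\<close>

lemma wave_bilinear_eq_cross_bounded:
  assumes "finite A" "\<And>i. i \<in> A \<Longrightarrow> 0 \<le> P i" "0 \<le> r"
  shows "bilinear_eq M (2 * r) (wave M P A c) (wave M P A (\<lambda>i. c i - min r (real M * P i))) \<and>
    (\<forall>p\<ge>0. (\<forall>i\<in>A. P i \<le> p) \<longrightarrow> r \<le> real M * p \<longrightarrow>
      cross_bounded M (2 * p) (2 * r) (wave M P A c) (wave M P A (\<lambda>i. c i - min r (real M * P i))))"
  using assms
proof (induction A rule: finite_ranking_induct[where f = P])
  case empty
  then show ?case
    by (simp add: bilinear_eq_def cross_bounded_def)
next
  case (insert a A)
  let ?h = "\<lambda>A. wave M P A (\<lambda>i. c i - min r (real M * P i))"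
  have a: "0 \<le> P a"
    using insert by auto
  \<comment> \<open>As \<open>P a\<close> is the largest, \<open>M * P a \<le> r\<close> makes the
    whole set a pure delay. Otherwise \<open>a\<close> loses exactly \<open>r\<close> from its
    phase.\<close>
  consider "a \<in> A" | "real M * P a \<le> r" | "a \<notin> A" "r \<le> real M * P a"
    by linarith
  then show ?case
  proof cases
    case 1
    then show ?thesis
      using insert by (simp add: insert_absorb)
  next
    case 2
    have h: "?h (insert a A) = (\<lambda>s. wave M P (insert a A) c (s - int M))"
    proof (rule wave_delay)
      fix i assume "i \<in> insert a A"
      then have "real M * P i \<le> real M * P a"
        using insert.hyps by (auto intro: mult_left_mono)
      then show "real M * P i \<le> r"
        using 2 by linarith
    qed
    have "slope_bounded M (2 * P a) (wave M P (insert a A) c)"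
      using insert a by (intro slope_bounded_wave) auto
    then have "bilinear_eq M (2 * r) (wave M P (insert a A) c) (?h (insert a A))"
      unfolding h using 2 by (intro bilinear_eq_delay) auto
    moreover have "cross_bounded M (2 * p) (2 * r) (wave M P (insert a A) c) (?h (insert a A))"
      if "r \<le> real M * p" for p
      unfolding h using that by (simp add: cross_bounded_def)
    ultimately show ?thesis
      by blast
  next
    case 3
    have f: "wave M P (insert a A) c = add_soliton M (2 * P a) (2 * c a) (wave M P A c)"
      using insert 3 by (intro wave_insert_largest) auto
    have h: "?h (insert a A) = add_soliton M (2 * P a) (2 * c a - 2 * r) (?h A)"
      using insert 3 wave_insert_largest[of A a P M "\<lambda>i. c i - min r (real M * P i)"]
      by (simp add: min_absorb1 algebra_simps)
    have sl: "slope_bounded M (2 * P a) (wave M P A c')" for c'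
      using insert a by (intro slope_bounded_wave) auto
    \<comment> \<open>The cross bound is available at \<open>P a\<close>, which bounds all
      \<open>P i\<close> and satisfies \<open>r \<le> M * P a\<close>.\<close>
    have e: "bilinear_eq M (2 * r) (wave M P A c) (?h A)"
      and c: "cross_bounded M (2 * P a) (2 * r) (wave M P A c) (?h A)"
      using insert a 3 by auto
    have "cross_bounded M (2 * P a) (2 * r) (wave M P (insert a A) c) (?h (insert a A))"
      unfolding f h by (rule cross_bounded_add_soliton[OF sl e c])
    moreover have "bilinear_eq M (2 * r) (wave M P (insert a A) c) (?h (insert a A))"
      unfolding f h by (rule bilinear_eq_add_soliton[OF sl sl e c])
    ultimately show ?thesis
      by (auto elim: cross_bounded_mono)
  qed
qed

section \<open>From the recursive solutions to waves, and the equation\<close>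

lemma T_eq_wave:
  "T M R k P C s j = wave M P {1..k} (\<lambda>i. C i - signed_sum 0 j (Omega M R (P i))) s"
proof (induction k arbitrary: C)
  case (Suc k)
  have "{1..Suc k} = insert (Suc k) {1..k}"
    by auto
  moreover have "(\<lambda>i. C i - interaction M (P (Suc k)) (P i) - signed_sum 0 j (Omega M R (P i)))
    = (\<lambda>i. C i - signed_sum 0 j (Omega M R (P i)) - interaction M (P (Suc k)) (P i))"
    by auto
  ultimately show ?case
    using Suc by (simp add: vertex_op_def wave_insert eta_def algebra_simps)
qed simp

text \<open>Allows the tuples to be extended at \<open>Suc N\<close> without changing the solution
  with \<open>N\<close> solitons.\<close>

lemma T_cong:
  assumes "\<And>i. i \<in> {1..k} \<Longrightarrow> P i = P' i" "\<And>i. i \<in> {1..k} \<Longrightarrow> C i = C' i"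
  shows "T M R k P C = T M R k P' C'"
  using assms unfolding fun_eq_iff T_eq_wave wave_def by (intro allI tau_cong) auto

text \<open>The sign convention makes the increment uniform in \<open>j\<close>; at
  \<open>j = -1\<close> the sum passes from \<open>- f 0\<close> to \<open>0\<close>.\<close>

lemma signed_sum_Suc: "signed_sum 0 (j + 1) f = signed_sum 0 j f + f (j + 1)"
proof -
  consider "j = -1" | "j < -1" | "0 \<le> j"
    by linarith
  then show ?thesis
  proof cases
    case 2
    then have "{j + 1..0} = insert (j + 1) {j + 1 + 1..0}"
      by auto
    then show ?thesis
      using 2 by (simp add: signed_sum_def)
  next
    case 3
    then have "{1..j + 1} = insert (j + 1) {1..j}"
      by auto
    then show ?thesis
      using 3 by (simp add: signed_sum_def)
  qed (simp add: signed_sum_def)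
qed

theorem solves_uhKdV_T:
  assumes R: "\<And>j. R j \<ge> 0" and P: "\<And>i. i \<in> {1..N} \<Longrightarrow> P i \<ge> 0"
  shows "solves_uhKdV M R (T M R N P C)"
  unfolding solves_uhKdV_def
proof (intro allI)
  fix s j
  define c where "c i = C i - signed_sum 0 j (Omega M R (P i))" for i
  have f: "T M R N P C s j = wave M P {1..N} c s" for s
    unfolding T_eq_wave c_def ..
  \<comment> \<open>The increment is \<open>Omega\<close> at \<open>j + 1\<close>, whose index shift
    produces \<open>R j\<close>.\<close>
  have h: "T M R N P C s (j + 1) = wave M P {1..N} (\<lambda>i. c i - min (R j) (real M * P i)) s" for s
    by (simp add: T_eq_wave signed_sum_Suc Omega_def c_def diff_diff_eq)
  have "bilinear_eq M (2 * R j) (wave M P {1..N} c)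
      (wave M P {1..N} (\<lambda>i. c i - min (R j) (real M * P i)))"
    using wave_bilinear_eq_cross_bounded[of "{1..N}" P "R j"] R P by auto
  from bilinear_eqD[OF this, of s]
  show "T M R N P C (s + int M + 1) (j + 1) + T M R N P C s j =
      max (T M R N P C (s + int M + 1) j + T M R N P C s (j + 1) - 2 * R j)
          (T M R N P C (s + 1) j + T M R N P C (s + int M) (j + 1))"
    unfolding f h .
qed

theorem mainTheorem3:
  fixes M N :: nat and R :: "int \<Rightarrow> real" and P C :: "nat \<Rightarrow> real"
  assumes "M \<ge> 1"
    and "\<And>j. R j \<ge> 0"
    and "\<And>i. i \<in> {1..N} \<Longrightarrow> P i \<ge> 0"
  shows "solves_uhKdV M R (T M R N P C) \<and>
    soliton_solution M R N (T M R N P C) \<and>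
    (\<forall>p c. p \<ge> 0 \<longrightarrow>
       vertex_op M R P p c (T M R N P) C
         = T M R (Suc N) (P(Suc N := p)) (C(Suc N := c)) \<and>
       soliton_solution M R (Suc N) (vertex_op M R P p c (T M R N P) C))"
proof -
  have sol: "soliton_solution M R k (T M R k Q D)" if "\<And>i. i \<in> {1..k} \<Longrightarrow> Q i \<ge> 0" for k Q D
    using solves_uhKdV_T[of R k Q M D] assms(2) that unfolding soliton_solution_def by blast
  have step: "vertex_op M R P p c (T M R N P) C = T M R (Suc N) (P(Suc N := p)) (C(Suc N := c))"
    for p c
  proof (intro ext)
    fix s j
    have "T M R N (P(Suc N := p)) (C(Suc N := c)) = T M R N P C"
      "T M R N (P(Suc N := p)) (\<lambda>i. (C(Suc N := c)) i - interaction M p ((P(Suc N := p)) i))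
        = T M R N P (\<lambda>i. C i - interaction M p (P i))"
      by (rule T_cong; simp)+
    then show "vertex_op M R P p c (T M R N P) C s j
        = T M R (Suc N) (P(Suc N := p)) (C(Suc N := c)) s j"
      by (simp add: vertex_op_def)
  qed
  have "soliton_solution M R (Suc N) (vertex_op M R P p c (T M R N P) C)" if "p \<ge> 0" for p c
    unfolding step using that assms(3) by (intro sol) auto
  then show ?thesis
    using sol[of N P C] assms(3) step unfolding soliton_solution_def by auto
qed

end
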